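(* There is an absolute constant $C>0$ such that the following holds. Let $\alpha>0$, $\varepsilon>0$ and $\delta\in(0,1)$. For every rooted tree $\mathcal{T}$ of depth $d$ (and any arity), there is an $(\varepsilon,\delta)$-differentially private algorithm for tree aggregation on $\mathcal{T}$ whose $\alpha$-$\mathsf{mRMSE}$ is at most $\frac{C}{\alpha^3}\cdot\left(\frac1\varepsilon\log\left(\frac{2d}\delta\right)+1\right)$.
   Context: Tree aggregation: $\mathcal{T}$ is a rooted tree whose structure is known in advance; its depth $d$ is the maximum number of nodes on a root-to-leaf path. The input is a vector $x\in\mathbb{N}^{\mathsf{leaves}(\mathcal{T})}$ of non-negative integers; each node $u$ has weight $w_u=\sum_{v \text{ a leaf under } u} x_v$ (a leaf is under itself). An algorithm outputs a randomized estimate $\tilde w\in\mathbb{R}^{\mathsf{nodes}(\mathcal{T})}$ of $w$. A randomized algorithm $\mathcal{A}$ is $(\varepsilon,\delta)$-differentially private if $\Pr[\mathcal{A}(x)\in S]\le e^\varepsilon\Pr[\mathcal{A}(x')\in S]+\delta$ for every measurable $S$ and all inputs $x,x'$ with $\|x-x'\|_1=1$. For $\alpha\ge 0$, an estimate $\tilde z$ of $z\ge 0$ has $\mathsf{RMSE}_\alpha(\tilde z,z)=\sqrt{\mathbb{E}[(\max\{|\tilde z-z|-\alpha z,0\})^2]}$, and the $\alpha$-$\mathsf{mRMSE}$ of an algorithm $\mathcal{M}$ is $\max_{x}\max_{u\in\mathsf{nodes}(\mathcal{T})}\mathsf{RMSE}_\alpha(\mathcal{M}(x)_u,w_u)$,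 the maximum over all inputs $x$. $\log$ is base 2. *)

theory Defs
  imports "HOL-Probability.Probability" "HOL-Library.Sublist"
begin

text \<open>Every finite rooted tree is isomorphic to a rose tree. A node is identified with the list of
  child indices that leads to it from the root; \<open>[]\<close> is the root.\<close>

datatype rtree = Node "rtree list"

function nodes :: "rtree \<Rightarrow> nat list set" where
  "nodes (Node ts) = insert [] (\<Union>i\<in>{..<length ts}. (#) i ` nodes (ts ! i))"
  by pat_completeness auto
termination
  by (relation "Wellfounded.measure size")
    (auto simp: less_Suc_eq_le intro!: size_list_estimation'[OF nth_mem order.refl])

lemma finite_nodes: "finite (nodes t)"
  by (induction t rule: nodes.induct) auto

lemma root_in_nodes: "[] \<in> nodes t"
  by (cases t) auto

definition leaves :: "rtree \<Rightarrow> nat list set" where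
  "leaves t = {u \<in> nodes t. \<forall>i. u @ [i] \<notin> nodes t}"

text \<open>The root-to-leaf path ending in \<open>v\<close> has \<open>length v + 1\<close> nodes, namely the prefixes of \<open>v\<close>.\<close>

definition depth :: "rtree \<Rightarrow> nat" where
  "depth t = Max ((\<lambda>v. length v + 1) ` leaves t)"

definition inputs :: "rtree \<Rightarrow> (nat list \<Rightarrow> nat) set" where
  "inputs t = leaves t \<rightarrow>\<^sub>E UNIV"

definition weight :: "rtree \<Rightarrow> (nat list \<Rightarrow> nat) \<Rightarrow> nat list \<Rightarrow> nat" where
  "weight t x u = (\<Sum>v | v \<in> leaves t \<and> prefix u v. x v)"

definition l1_dist :: "rtree \<Rightarrow> (nat list \<Rightarrow> nat) \<Rightarrow> (nat list \<Rightarrow> nat) \<Rightarrow> real" where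
  "l1_dist t x x' = (\<Sum>v\<in>leaves t. \<bar>real (x v) - real (x' v)\<bar>)"

text \<open>The space \<open>\<real>\<^bsup>nodes\<^esup>\<close> of estimates, with its Borel sigma-algebra.\<close>

definition estimates :: "rtree \<Rightarrow> (nat list \<Rightarrow> real) measure" where
  "estimates t = (\<Pi>\<^sub>M u\<in>nodes t. borel)"

text \<open>A randomized algorithm maps each input to the distribution of its output.\<close>

definition tree_algorithm ::
    "rtree \<Rightarrow> ((nat list \<Rightarrow> nat) \<Rightarrow> (nat list \<Rightarrow> real) measure) \<Rightarrow> bool" where
  "tree_algorithm t A \<longleftrightarrow>
     (\<forall>x\<in>inputs t. prob_space (A x) \<and> sets (A x) = sets (estimates t))"

definition differentially_private ::
    "real \<Rightarrow> real \<Rightarrow> rtree \<Rightarrow> ((nat list \<Rightarrow> nat) \<Rightarrow> (nat list \<Rightarrow> real) measure) \<Rightarrow> bool" where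
  "differentially_private \<epsilon> \<delta> t A \<longleftrightarrow>
     (\<forall>x\<in>inputs t. \<forall>x'\<in>inputs t. l1_dist t x x' = 1 \<longrightarrow>
        (\<forall>S\<in>sets (estimates t). measure (A x) S \<le> exp \<epsilon> * measure (A x') S + \<delta>))"

text \<open>Errors live in \<^typ>\<open>ennreal\<close>, so that an estimate without a finite second moment has
  infinite error (the Bochner integral would give 0).\<close>

definition ennsqrt :: "ennreal \<Rightarrow> ennreal" where
  "ennsqrt a = (if a = \<top> then \<top> else ennreal (sqrt (enn2real a)))"

definition RMSE :: "real \<Rightarrow> 'a measure \<Rightarrow> ('a \<Rightarrow> real) \<Rightarrow> real \<Rightarrow> ennreal" where
  "RMSE \<alpha> M Z z = ennsqrt (\<integral>\<^sup>+ \<omega>. ennreal ((max (\<bar>Z \<omega> - z\<bar> - \<alpha> * z) 0)\<^sup>2) \<partial>M)"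

definition mRMSE ::
    "real \<Rightarrow> rtree \<Rightarrow> ((nat list \<Rightarrow> nat) \<Rightarrow> (nat list \<Rightarrow> real) measure) \<Rightarrow> ennreal" where
  "mRMSE \<alpha> t A =
     (SUP x\<in>inputs t. SUP u\<in>nodes t. RMSE \<alpha> (A x) (\<lambda>w. w u) (real (weight t x u)))"

end

theory Submission
  imports Defs
begin

text \<open>
  For \<open>\<alpha> \<ge> 1\<close> the constant estimate 0 has no error. For \<open>\<alpha> < 1\<close> fix geometrically growing thresholds
  \<open>T 0 < T 1 < \<dots>\<close> and walk down the tree. A node at level \<open>i + 1\<close> keeps its level if its weight plus
  fresh noise reaches \<open>T i\<close> plus a noise that is shared by the whole walk at this level; otherwise it
  drops to level \<open>i\<close>, where fresh noise for the threshold is drawn. The estimate of a node is the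
  threshold of its level.

  All noise of level \<open>i\<close> lies in \<open>{0..m i}\<close> with \<open>m i\<close> a small fraction of \<open>T i\<close>, so the accuracy holds
  surely. As a node at level \<open>i + 1\<close> has weight below \<open>2 (T i - m i)\<close>, at most one of its children can
  keep the level; hence the nodes at which a test of this level is in doubt form a single downward
  path, and the sparse vector argument applies: adding one unit to a leaf is absorbed by shifting
  the noise at the end of this path, removing one unit by also shifting the shared noise. A shift
  at level \<open>i\<close> costs a factor \<open>exp (\<epsilon> i)\<close> and an additive error for hitting the boundary of the noise,
  and both series converge because the noise may grow with the threshold.
\<close>

section \<open>Approximate domination of distributions\<close>

text \<open>With \<open>K = exp \<epsilon>\<close> and \<open>D = \<delta>\<close> this is one
  direction of (\<epsilon>,\<delta>)-indistinguishability. It is tested by functions into [0,1]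
  rather than by events, so that the conditional expectation over a later random stage is itself a
  test.\<close>

definition approx_le :: "ennreal \<Rightarrow> ennreal \<Rightarrow> 'a pmf \<Rightarrow> 'a pmf \<Rightarrow> bool" where
  "approx_le K D p q \<longleftrightarrow>
     (\<forall>h. (\<forall>a. h a \<le> 1) \<longrightarrow> (\<integral>\<^sup>+a. h a \<partial>p) \<le> K * (\<integral>\<^sup>+a. h a \<partial>q) + D)"

lemma approx_leD:
  "approx_le K D p q \<Longrightarrow> (\<And>a. h a \<le> 1) \<Longrightarrow> (\<integral>\<^sup>+a. h a \<partial>p) \<le> K * (\<integral>\<^sup>+a. h a \<partial>q) + D"
  unfolding approx_le_def by blast

lemma approx_le_refl: "approx_le 1 0 p p"
  by (simp add: approx_le_def)

lemma approx_le_mono: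
  assumes "approx_le K D p q" "K \<le> K'" "D \<le> D'"
  shows "approx_le K' D' p q"
  unfolding approx_le_def
proof (intro allI impI)
  fix h :: "'a \<Rightarrow> ennreal" assume "\<forall>a. h a \<le> 1"
  then have "(\<integral>\<^sup>+a. h a \<partial>p) \<le> K * (\<integral>\<^sup>+a. h a \<partial>q) + D"
    using approx_leD[OF assms(1)] by blast
  also have "\<dots> \<le> K' * (\<integral>\<^sup>+a. h a \<partial>q) + D'"
    using assms by (intro add_mono mult_right_mono) auto
  finally show "(\<integral>\<^sup>+a. h a \<partial>p) \<le> K' * (\<integral>\<^sup>+a. h a \<partial>q) + D'" .
qed

lemma nn_integral_pmf_le_1:
  assumes "\<And>a. h a \<le> 1" shows "(\<integral>\<^sup>+a. h a \<partial>measure_pmf p) \<le> 1"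
proof -
  have "(\<integral>\<^sup>+a. h a \<partial>p) \<le> (\<integral>\<^sup>+a. 1 \<partial>p)"
    using assms by (intro nn_integral_mono) auto
  then show ?thesis by simp
qed

text \<open>Capping the inner bound at 1 before the outer one is applied keeps the additive errors
  additive, without a factor \<open>K1\<close> on \<open>D2\<close>.\<close>

lemma approx_le_bind:
  assumes pq: "approx_le K1 D1 p q"
    and fg: "\<And>a. a \<in> set_pmf p \<Longrightarrow> a \<in> set_pmf q \<Longrightarrow> approx_le K2 D2 (f a) (g a)"
  shows "approx_le (K1 * K2) (D1 + D2) (bind_pmf p f) (bind_pmf q g)"
  unfolding approx_le_def
proof (intro allI impI)
  fix h :: "'b \<Rightarrow> ennreal" assume h: "\<forall>a. h a \<le> 1"
  define G where "G a = (\<integral>\<^sup>+b. h b \<partial>g a)" for a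
  \<comment> \<open>Outside the support of \<open>q\<close> nothing is known about
    \<open>f a\<close>, so the trivial bound 1 stands there; the integral over \<open>q\<close> does
    not see these points. Hence only the common support has to be compared.\<close>
  define \<phi> where "\<phi> a = (if a \<in> set_pmf q then min 1 (K2 * G a) else 1)" for a
  have le: "(\<integral>\<^sup>+b. h b \<partial>f a) \<le> \<phi> a + D2" if "a \<in> set_pmf p" for a
  proof (cases "a \<in> set_pmf q")
    case True
    have 1: "(\<integral>\<^sup>+b. h b \<partial>f a) \<le> K2 * G a + D2"
      unfolding G_def using approx_leD[OF fg[OF that True]] h by blast
    have 2: "(\<integral>\<^sup>+b. h b \<partial>f a) \<le> 1"
      using h by (intro nn_integral_pmf_le_1) auto
    then have "(\<integral>\<^sup>+b. h b \<partial>f a) \<le> 1 + D2"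
      by (simp add: add_increasing2)
    with 1 show ?thesis using True by (auto simp: \<phi>_def min_def)
  next
    case False
    have "(\<integral>\<^sup>+b. h b \<partial>f a) \<le> 1"
      using h by (intro nn_integral_pmf_le_1) auto
    then have "(\<integral>\<^sup>+b. h b \<partial>f a) \<le> 1 + D2"
      by (simp add: add_increasing2)
    then show ?thesis using False by (simp add: \<phi>_def)
  qed
  have "(\<integral>\<^sup>+b. h b \<partial>bind_pmf p f) = (\<integral>\<^sup>+a. \<integral>\<^sup>+b. h b \<partial>f a \<partial>p)"
    by simp
  also have "\<dots> \<le> (\<integral>\<^sup>+a. \<phi> a + D2 \<partial>p)"
    using le by (intro nn_integral_mono_AE) (auto simp: AE_measure_pmf_iff)
  also have "\<dots> = (\<integral>\<^sup>+a. \<phi> a \<partial>p) + D2"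
    by (subst nn_integral_add) auto
  also have "\<dots> \<le> (K1 * (\<integral>\<^sup>+a. \<phi> a \<partial>q) + D1) + D2"
    by (intro add_mono approx_leD[OF pq]) (auto simp: \<phi>_def)
  also have "\<dots> \<le> (K1 * (\<integral>\<^sup>+a. K2 * G a \<partial>q) + D1) + D2"
    by (intro add_mono mult_left_mono nn_integral_mono_AE)
       (auto simp: \<phi>_def AE_measure_pmf_iff)
  also have "(\<integral>\<^sup>+a. K2 * G a \<partial>q) = K2 * (\<integral>\<^sup>+b. h b \<partial>bind_pmf q g)"
    by (simp add: G_def nn_integral_cmult)
  finally show "(\<integral>\<^sup>+b. h b \<partial>bind_pmf p f) \<le>
      K1 * K2 * (\<integral>\<^sup>+b. h b \<partial>bind_pmf q g) + (D1 + D2)"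
    by (simp add: mult.assoc add.assoc)
qed

lemma approx_le_bind_same:
  assumes "\<And>a. a \<in> set_pmf p \<Longrightarrow> approx_le K D (f a) (g a)"
  shows "approx_le K D (bind_pmf p f) (bind_pmf p g)"
  using approx_le_bind[OF approx_le_refl, of p K D f g] assms by simp

lemma approx_le_map:
  assumes "approx_le K D p q" shows "approx_le K D (map_pmf f p) (map_pmf f q)"
  using assms by (auto simp: approx_le_def nn_integral_map_pmf)

text \<open>The core of the sparse vector argument. Passing is at least as likely on the right, so
  the passing branch pays only for its continuation; the factor \<open>k\<close> is paid in the
  failing branch alone. A chain of passed tests therefore accumulates no factors, only one additive
  \<open>d\<close> per test. \<open>D\<close> is not doubled, as the two branch probabilities sum to
  1.\<close>

lemma approx_le_test:
  fixes N :: "'a pmf" and P P' Q Q' :: "'b pmf"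
  assumes AA: "\<And>a. A a \<Longrightarrow> A' a"
    and fail: "emeasure N {a. \<not> A a} \<le> k * emeasure N {a. \<not> A' a} + d"
    and P: "approx_le K D P P'"
    and Q: "\<And>a. a \<in> set_pmf N \<Longrightarrow> \<not> A a \<Longrightarrow> approx_le K1 D Q Q'"
    and K: "k * K1 \<le> K"
  shows "approx_le K (d + D) (bind_pmf N (\<lambda>a. if A a then P else Q))
           (bind_pmf N (\<lambda>a. if A' a then P' else Q'))"
  unfolding approx_le_def
proof (intro allI impI)
  fix h :: "'b \<Rightarrow> ennreal" assume h: "\<forall>a. h a \<le> 1"
  have split: "(\<integral>\<^sup>+b. h b \<partial>bind_pmf N (\<lambda>a. if B a then R else S)) =
      emeasure N {a. B a} * (\<integral>\<^sup>+b. h b \<partial>R) + emeasure N {a. \<not> B a} * (\<integral>\<^sup>+b. h b \<partial>S)"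
    for B R S
  proof -
    have "(\<integral>\<^sup>+b. h b \<partial>bind_pmf N (\<lambda>a. if B a then R else S)) =
       (\<integral>\<^sup>+a. (\<integral>\<^sup>+b. h b \<partial>R) * indicator {a. B a} a + (\<integral>\<^sup>+b. h b \<partial>S) * indicator {a. \<not> B a} a \<partial>N)"
      by (auto intro!: nn_integral_cong)
    also have "\<dots> = emeasure N {a. B a} * (\<integral>\<^sup>+b. h b \<partial>R) + emeasure N {a. \<not> B a} * (\<integral>\<^sup>+b. h b \<partial>S)"
      by (subst nn_integral_add) (auto simp: nn_integral_cmult_indicator mult.commute[of "emeasure _ _"])
    finally show ?thesis .
  qed
  define a b a' b' where "a = emeasure N {a. A a}" and "b = emeasure N {a. \<not> A a}"
    and "a' = emeasure N {a. A' a}" and "b' = emeasure N {a. \<not> A' a}"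
  define pp qq pp' qq' where "pp = (\<integral>\<^sup>+b. h b \<partial>P)" and "qq = (\<integral>\<^sup>+b. h b \<partial>Q)"
    and "pp' = (\<integral>\<^sup>+b. h b \<partial>P')" and "qq' = (\<integral>\<^sup>+b. h b \<partial>Q')"
  have aa': "a \<le> a'" unfolding a_def a'_def using AA by (intro emeasure_mono) auto
  have ab: "a + b = 1"
  proof -
    have "a + b = emeasure N ({a. A a} \<union> {a. \<not> A a})"
      unfolding a_def b_def by (subst plus_emeasure) auto
    also have "{a. A a} \<union> {a. \<not> A a} = UNIV" by auto
    finally show ?thesis using measure_pmf.emeasure_space_1[of N] by simp
  qed
  have pp: "pp \<le> K * pp' + D" unfolding pp_def pp'_def using approx_leD[OF P] h by blast
  \<comment> \<open>The cap keeps the additive error \<open>d\<close> of the test from being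
    multiplied by \<open>K1 * qq'\<close>.\<close>
  define c where "c = min 1 (K1 * qq')"
  have qq: "b * qq \<le> b * (c + D)"
  proof (cases "\<exists>a\<in>set_pmf N. \<not> A a")
    case True
    then have "qq \<le> K1 * qq' + D" unfolding qq_def qq'_def using approx_leD[OF Q] h by blast
    moreover have "qq \<le> 1" unfolding qq_def using h by (intro nn_integral_pmf_le_1) auto
    then have "qq \<le> 1 + D" by (simp add: add_increasing2)
    ultimately show ?thesis by (intro mult_left_mono) (auto simp: c_def min_def)
  next
    case False
    then have "b = 0" unfolding b_def
      by (auto simp: emeasure_eq_AE measure_pmf.emeasure_eq_measure measure_pmf_zero_iff)
    then show ?thesis by simp
  qed
  have "a * pp + b * qq \<le> a * (K * pp' + D) + b * (c + D)"
    by (intro add_mono mult_left_mono pp qq) auto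
  also have "\<dots> = a * (K * pp') + b * c + (a + b) * D"
    by (simp add: algebra_simps)
  also have "\<dots> \<le> a' * (K * pp') + (k * b' + d) * c + D"
    using fail unfolding ab b_def[symmetric] b'_def[symmetric]
    by (auto intro!: add_mono mult_right_mono aa')
  also have "\<dots> \<le> a' * (K * pp') + (K * b' * qq' + d) + D"
  proof (intro add_mono order.refl)
    have "(k * b' + d) * c = k * b' * c + d * c" by (simp add: algebra_simps)
    also have "\<dots> \<le> k * b' * (K1 * qq') + d * 1"
      by (intro add_mono mult_left_mono) (auto simp: c_def)
    also have "\<dots> = (k * K1) * (b' * qq') + d" by (simp add: algebra_simps)
    also have "\<dots> \<le> K * (b' * qq') + d" by (intro add_mono mult_right_mono K) auto
    finally show "(k * b' + d) * c \<le> K * b' * qq' + d" by (simp add: mult.assoc)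
  qed
  also have "\<dots> = K * (a' * pp' + b' * qq') + (d + D)"
    by (simp add: algebra_simps)
  finally show "(\<integral>\<^sup>+b. h b \<partial>bind_pmf N (\<lambda>a. if A a then P else Q)) \<le>
      K * (\<integral>\<^sup>+b. h b \<partial>bind_pmf N (\<lambda>a. if A' a then P' else Q')) + (d + D)"
    unfolding split a_def b_def a'_def b'_def pp_def qq_def pp'_def qq'_def .
qed

lemma approx_le_Pi_pmf_single:
  assumes "finite A" "k \<in> A" "approx_le K D (p k) (q k)" "\<And>j. j \<in> A \<Longrightarrow> j \<noteq> k \<Longrightarrow> p j = q j"
  shows "approx_le K D (Pi_pmf A c p) (Pi_pmf A c q)"
proof -
  have A: "insert k (A - {k}) = A" using assms by auto
  have eq: "Pi_pmf (A - {k}) c p = Pi_pmf (A - {k}) c q"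
    using assms by (intro Pi_pmf_cong) auto
  have "approx_le (K * 1) (D + 0) (bind_pmf (p k) R) (bind_pmf (q k) R)"
    for R :: "'b \<Rightarrow> ('a \<Rightarrow> 'b) pmf"
    by (intro approx_le_bind approx_le_refl assms(3))
  then have "approx_le K D
      (Pi_pmf (insert k (A - {k})) c p) (Pi_pmf (insert k (A - {k})) c q)"
    using assms by (subst (1 2) Pi_pmf_insert') (auto simp: eq)
  then show ?thesis unfolding A by simp
qed

lemma approx_le_Pi_pmf_two:
  assumes "finite A" "k \<in> A" "j \<in> A" "j \<noteq> k"
    "approx_le K D (p k) (q k)" "approx_le K' D' (p j) (q j)"
    "\<And>i. i \<in> A \<Longrightarrow> i \<noteq> k \<Longrightarrow> i \<noteq> j \<Longrightarrow> p i = q i"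
  shows "approx_le (K * K') (D + D') (Pi_pmf A c p) (Pi_pmf A c q)"
proof -
  have A: "insert k (A - {k}) = A" using assms by auto
  have "approx_le K' D' (Pi_pmf (A - {k}) c p) (Pi_pmf (A - {k}) c q)"
    using assms by (intro approx_le_Pi_pmf_single[of _ j]) auto
  then have "approx_le K' D' (map_pmf (\<lambda>f. f(k := y)) (Pi_pmf (A - {k}) c p))
     (map_pmf (\<lambda>f. f(k := y)) (Pi_pmf (A - {k}) c q))" for y
    by (rule approx_le_map)
  then have "approx_le (K * K') (D + D')
      (Pi_pmf (insert k (A - {k})) c p) (Pi_pmf (insert k (A - {k})) c q)"
    using assms by (subst (1 2) Pi_pmf_insert') (auto simp: map_pmf_def intro!: approx_le_bind)
  then show ?thesis unfolding A by simp
qed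

section \<open>Weights of subtrees\<close>

lemma Cons_in_nodes_Node:
  "k # u \<in> nodes (Node ts) \<longleftrightarrow> k < length ts \<and> u \<in> nodes (ts ! k)"
  by auto

lemma leaves_Node:
  "leaves (Node ts) = (if ts = [] then {[]} else \<Union>k<length ts. (#) k ` leaves (ts ! k))"
proof (cases "ts = []")
  case True
  then show ?thesis by (auto simp: leaves_def)
next
  case False
  have "[] \<notin> leaves (Node ts)"
    using False root_in_nodes[of "ts ! 0"] by (auto simp: leaves_def image_iff intro!: exI[of _ 0])
  then have "v \<in> leaves (Node ts) \<longleftrightarrow> v \<in> (\<Union>k<length ts. (#) k ` leaves (ts ! k))" for v
    by (cases v) (auto simp: leaves_def Cons_in_nodes_Node simp del: nodes.simps)
  then show ?thesis using False by auto
qed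

lemma Cons_in_leaves_Node:
  "k # v \<in> leaves (Node ts) \<longleftrightarrow> k < length ts \<and> v \<in> leaves (ts ! k)"
  by (auto simp: leaves_Node)

lemma finite_leaves [simp]: "finite (leaves t)"
  using finite_nodes[of t] by (auto simp: leaves_def)

lemma leaves_nonempty: "leaves t \<noteq> {}"
proof (induction t rule: nodes.induct)
  case (1 ts)
  then show ?case by (cases "ts = []") (auto simp: leaves_Node)
qed

lemma depth_child_less:
  assumes "k < length ts" shows "depth (ts ! k) < depth (Node ts)"
proof -
  have "depth (ts ! k) \<in> (\<lambda>v. length v + 1) ` leaves (ts ! k)"
    unfolding depth_def using leaves_nonempty by (intro Max_in) auto
  then obtain v where v: "v \<in> leaves (ts ! k)" "depth (ts ! k) = length v + 1" by auto
  then have "length (k # v) + 1 \<le> depth (Node ts)"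
    unfolding depth_def using assms
    by (intro Max_ge) (auto simp: Cons_in_leaves_Node intro!: rev_image_eqI[of "k # v"])
  with v show ?thesis by simp
qed

lemma depth_pos: "depth t > 0"
proof -
  have "depth t \<in> (\<lambda>v. length v + 1) ` leaves t"
    unfolding depth_def using leaves_nonempty by (intro Max_in) auto
  then show ?thesis by auto
qed

definition child :: "nat \<Rightarrow> (nat list \<Rightarrow> 'a) \<Rightarrow> nat list \<Rightarrow> 'a" where
  "child k x p = x (k # p)"

abbreviation total :: "rtree \<Rightarrow> (nat list \<Rightarrow> nat) \<Rightarrow> nat" where
  "total t x \<equiv> weight t x []"

lemma weight_Cons:
  assumes "k < length ts"
  shows "weight (Node ts) x (k # u) = weight (ts ! k) (child k x) u"
proof -
  have "{v \<in> leaves (Node ts). prefix (k # u) v} = (#) k ` {v \<in> leaves (ts ! k). prefix u v}"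
    using assms by (auto simp: leaves_Node split: if_splits)
  then show ?thesis
    unfolding weight_def by (simp add: sum.reindex child_def)
qed

lemma total_Node:
  assumes "ts \<noteq> []"
  shows "total (Node ts) x = (\<Sum>k<length ts. total (ts ! k) (child k x))"
proof -
  have "total (Node ts) x = (\<Sum>v\<in>(\<Union>k<length ts. (#) k ` leaves (ts ! k)). x v)"
    unfolding weight_def using assms by (intro sum.cong) (auto simp: leaves_Node)
  also have "\<dots> = (\<Sum>k<length ts. \<Sum>v\<in>(#) k ` leaves (ts ! k). x v)"
    by (rule sum.UNION_disjoint) auto
  finally show ?thesis
    unfolding weight_def by (simp add: sum.reindex child_def)
qed

lemma total_child_le: "k < length ts \<Longrightarrow> total (ts ! k) (child k x) \<le> total (Node ts) x"
  by (subst total_Node) (auto intro!: member_le_sum[of k])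

text \<open>Rules out two heavy siblings: at most one child can carry more than half of the weight
  of its parent. This is what confines the doubtful tests to a single path.\<close>

lemma total_two_children_le:
  assumes "j < length ts" "k < length ts" "j \<noteq> k"
  shows "total (ts ! j) (child j x) + total (ts ! k) (child k x) \<le> total (Node ts) x"
proof -
  have "(\<Sum>i\<in>{j, k}. total (ts ! i) (child i x)) \<le> (\<Sum>i<length ts. total (ts ! i) (child i x))"
    using assms by (intro sum_mono2) auto
  then show ?thesis using assms by (subst total_Node) auto
qed

lemma weight_le_total: "weight t x u \<le> total t x"
  unfolding weight_def by (intro sum_mono2) auto

definition incr :: "nat list \<Rightarrow> (nat list \<Rightarrow> nat) \<Rightarrow> nat list \<Rightarrow> nat" where
  "incr v x = x(v := Suc (x v))"

lemma total_incr: "v \<in> leaves t \<Longrightarrow> total t (incr v x) = Suc (total t x)"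
  unfolding weight_def incr_def by (simp add: sum.remove)

lemma child_incr: "child k (incr (k # v) x) = incr v (child k x)"
  by (auto simp: child_def incr_def fun_eq_iff)

lemma child_incr_other: "j \<noteq> k \<Longrightarrow> child j (incr (k # v) x) = child j x"
  by (auto simp: child_def incr_def fun_eq_iff)

section \<open>One level of the walk\<close>

definition graft :: "'a \<Rightarrow> (nat \<Rightarrow> nat list \<Rightarrow> 'a) \<Rightarrow> nat list \<Rightarrow> 'a" where
  "graft l g u = (case u of [] \<Rightarrow> l | k # p \<Rightarrow> g k p)"

lemma graft_simps [simp]: "graft l g [] = l" "graft l g (k # p) = g k p"
  by (simp_all add: graft_def)

text \<open>\<open>F\<close> labels the subtrees that fail the test, and \<open>\<theta>\<close>
  already contains the shared noise. The recursive call goes through \<open>map\<close> to be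
  primitive on the nested datatype; \<open>sweep_Node\<close> gives the form used below.\<close>

primrec sweep ::
    "(rtree \<Rightarrow> (nat list \<Rightarrow> nat) \<Rightarrow> (nat list \<Rightarrow> nat) pmf) \<Rightarrow> nat pmf \<Rightarrow> nat \<Rightarrow>
     rtree \<Rightarrow> (nat list \<Rightarrow> nat) \<Rightarrow> nat \<Rightarrow> (nat list \<Rightarrow> nat) pmf" where
  "sweep F N l (Node ts) = (\<lambda>x \<theta>. bind_pmf N (\<lambda>\<nu>.
     if \<theta> \<le> total (Node ts) x + \<nu>
     then map_pmf (graft l) (Pi_pmf {..<length ts} (\<lambda>_. 0)
            (\<lambda>k. (map (sweep F N l) ts ! k) (child k x) \<theta>))
     else F (Node ts) x))"

definition sweep_children where
  "sweep_children F N l ts x \<theta> = map_pmf (graft l) (Pi_pmf {..<length ts} (\<lambda>_. 0)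
            (\<lambda>k. sweep F N l (ts ! k) (child k x) \<theta>))"

lemma sweep_Node:
  "sweep F N l (Node ts) x \<theta> = bind_pmf N (\<lambda>\<nu>.
     if \<theta> \<le> total (Node ts) x + \<nu> then sweep_children F N l ts x \<theta> else F (Node ts) x)"
proof -
  have "Pi_pmf {..<length ts} (\<lambda>_. 0) (\<lambda>k. (map (sweep F N l) ts ! k) (child k x) \<theta>) =
     Pi_pmf {..<length ts} (\<lambda>_. 0) (\<lambda>k. sweep F N l (ts ! k) (child k x) \<theta>)"
    by (intro Pi_pmf_cong) auto
  then show ?thesis unfolding sweep.simps sweep_children_def by (simp only:)
qed

declare sweep.simps [simp del]

lemma approx_le_sweep_children:
  assumes "k < length ts"
    "approx_le K D (sweep F N l (ts ! k) (child k x) \<theta>) (sweep F N l (ts ! k) (child k x') \<theta>')"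
    "\<And>j. j < length ts \<Longrightarrow> j \<noteq> k \<Longrightarrow>
       sweep F N l (ts ! j) (child j x) \<theta> = sweep F N l (ts ! j) (child j x') \<theta>'"
  shows "approx_le K D (sweep_children F N l ts x \<theta>) (sweep_children F N l ts x' \<theta>')"
  unfolding sweep_children_def using assms
  by (intro approx_le_map approx_le_Pi_pmf_single[of _ k]) auto

locale sweep_level =
  fixes F :: "rtree \<Rightarrow> (nat list \<Rightarrow> nat) \<Rightarrow> (nat list \<Rightarrow> nat) pmf" and N :: "nat pmf"
    and K \<delta> :: ennreal and m :: nat
  assumes noise_le: "\<And>n. n \<in> set_pmf N \<Longrightarrow> n \<le> m"
    and noise_shift: "approx_le K \<delta> N (map_pmf Suc N)"
    and K_ge_1: "1 \<le> K"
begin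

text \<open>Here the test fails for every value of the noise, so a light subtree depends neither on
  \<open>\<theta>\<close> nor on the noise of this level and costs nothing.\<close>

lemma sweep_light:
  assumes "total t x + m < \<theta>" shows "sweep F N l t x \<theta> = F t x"
proof (cases t)
  case (Node ts)
  have "sweep F N l t x \<theta> = bind_pmf N (\<lambda>\<nu>. F t x)"
    unfolding Node sweep_Node using assms noise_le Node
    by (intro bind_pmf_cong refl) (force dest: noise_le)
  then show ?thesis by simp
qed

text \<open>A threshold raised by one is compensated by noise raised by one, and
  \<open>noise_shift\<close> states the price of that.\<close>

lemma fail_shift:
  "emeasure N {\<nu>. \<not> Suc \<theta> \<le> w + \<nu>} \<le> K * emeasure N {\<nu>. \<not> \<theta> \<le> w + \<nu>} + \<delta>"
proof -
  have "(\<integral>\<^sup>+\<nu>. indicator {\<nu>. \<not> Suc \<theta> \<le> w + \<nu>} \<nu> \<partial>N) \<le>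
      K * (\<integral>\<^sup>+\<nu>. indicator {\<nu>. \<not> Suc \<theta> \<le> w + \<nu>} \<nu> \<partial>map_pmf Suc N) + \<delta>"
    by (intro approx_leD[OF noise_shift]) (auto split: split_indicator)
  also have "(\<integral>\<^sup>+\<nu>. indicator {\<nu>. \<not> Suc \<theta> \<le> w + \<nu>} \<nu> \<partial>map_pmf Suc N) =
     (\<integral>\<^sup>+\<nu>. indicator {\<nu>. \<not> \<theta> \<le> w + \<nu>} \<nu> \<partial>N)"
    unfolding nn_integral_map_pmf by (intro nn_integral_cong) (auto split: split_indicator)
  finally show ?thesis by simp
qed

text \<open>Two siblings within \<open>m\<close> of \<open>\<theta>\<close> would together exceed
  the weight of their parent, so all children but at most one are light and agree on both sides.
  Along the remaining path only the test that fails pays \<open>K\<close>, while each of the at most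
  \<open>depth t\<close> tests adds \<open>\<delta>\<close>.\<close>

lemma sweep_shift:
  assumes "total t x + 2 * m < 2 * \<theta>"
  shows "approx_le K (of_nat (depth t) * \<delta>) (sweep F N l t x (Suc \<theta>)) (sweep F N l t x \<theta>)"
  using assms
proof (induction t arbitrary: x rule: nodes.induct)
  case (1 ts)
  let ?D = "of_nat (depth (Node ts) - 1) * \<delta>"
  have "approx_le K ?D (sweep_children F N l ts x (Suc \<theta>)) (sweep_children F N l ts x \<theta>)"
  proof (cases "\<exists>k<length ts. \<theta> \<le> total (ts ! k) (child k x) + m")
    case True
    then obtain k where k: "k < length ts" "\<theta> \<le> total (ts ! k) (child k x) + m" by blast
    show ?thesis
    proof (rule approx_le_sweep_children[OF k(1)])
      have "approx_le K (of_nat (depth (ts ! k)) * \<delta>)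
          (sweep F N l (ts ! k) (child k x) (Suc \<theta>)) (sweep F N l (ts ! k) (child k x) \<theta>)"
        using "1.prems" total_child_le[OF k(1), of x] k by (intro "1.IH") auto
      then show "approx_le K ?D
          (sweep F N l (ts ! k) (child k x) (Suc \<theta>)) (sweep F N l (ts ! k) (child k x) \<theta>)"
        using depth_child_less[OF k(1)]
        by (elim approx_le_mono) (auto intro!: mult_right_mono)
      fix j assume j: "j < length ts" "j \<noteq> k"
      have "total (ts ! j) (child j x) + m < \<theta>"
        using total_two_children_le[OF j(1) k(1) j(2), of x] k(2) "1.prems" by linarith
      then show "sweep F N l (ts ! j) (child j x) (Suc \<theta>) = sweep F N l (ts ! j) (child j x) \<theta>"
        by (simp add: sweep_light)
    qed
  next
    case False
    then have "sweep_children F N l ts x (Suc \<theta>) = sweep_children F N l ts x \<theta>"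
      unfolding sweep_children_def
      by (intro arg_cong[where f = "map_pmf _"] Pi_pmf_cong) (auto simp: sweep_light not_le)
    then show ?thesis
      using approx_le_mono[OF approx_le_refl K_ge_1] by simp
  qed
  note children = this
  have "approx_le K (\<delta> + ?D) (sweep F N l (Node ts) x (Suc \<theta>)) (sweep F N l (Node ts) x \<theta>)"
    unfolding sweep_Node
    by (rule approx_le_test[OF _ fail_shift children, where ?K1.0 = 1])
       (auto intro: approx_le_mono[OF approx_le_refl])
  moreover have "\<delta> + ?D = of_nat (depth (Node ts)) * \<delta>"
    using depth_pos[of "Node ts"] by (cases "depth (Node ts)") (auto simp: algebra_simps)
  ultimately show ?case by (simp only:)
qed

text \<open>Only the nodes above \<open>v\<close> see the extra unit, and it helps them pass. The
  first failure on this path pays \<open>K\<close> for the test and \<open>K'\<close> for the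
  continuation in \<open>F\<close>. A failing node has weight below \<open>\<theta> \<le> U\<close>,
  so \<open>F\<close> need only be controlled there.\<close>

lemma sweep_up:
  assumes F: "\<And>t x v. v \<in> leaves t \<Longrightarrow> depth t \<le> d \<Longrightarrow> total t x < U \<Longrightarrow>
        approx_le K' D (F t x) (F t (incr v x))"
    and "1 \<le> K'" "\<theta> \<le> U" "v \<in> leaves t" "depth t \<le> d"
  shows "approx_le (K * K') (of_nat (depth t) * \<delta> + D) (sweep F N l t x \<theta>) (sweep F N l t (incr v x) \<theta>)"
  using assms(4-)
proof (induction t arbitrary: x v rule: nodes.induct)
  case (1 ts)
  have KK: "1 \<le> K * K'" using mult_mono[OF K_ge_1 \<open>1 \<le> K'\<close>] by simp
  let ?D = "of_nat (depth (Node ts) - 1) * \<delta> + D"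
  have "approx_le (K * K') ?D (sweep_children F N l ts x \<theta>) (sweep_children F N l ts (incr v x) \<theta>)"
  proof (cases v)
    case (Cons k p)
    with "1.prems" have k: "k < length ts" "p \<in> leaves (ts ! k)"
      by (auto simp: Cons_in_leaves_Node)
    show ?thesis unfolding Cons
    proof (rule approx_le_sweep_children[OF k(1)])
      have "approx_le (K * K') (of_nat (depth (ts ! k)) * \<delta> + D)
          (sweep F N l (ts ! k) (child k x) \<theta>) (sweep F N l (ts ! k) (child k (incr (k # p) x)) \<theta>)"
        using "1.prems" depth_child_less[OF k(1)] k unfolding child_incr by (intro "1.IH") auto
      then show "approx_le (K * K') ?D
          (sweep F N l (ts ! k) (child k x) \<theta>) (sweep F N l (ts ! k) (child k (incr (k # p) x)) \<theta>)"
        using depth_child_less[OF k(1)]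
        by (elim approx_le_mono) (auto intro!: mult_right_mono add_mono)
    qed (simp add: child_incr_other)
  next
    case Nil
    with "1.prems" have "ts = []" by (auto simp: leaves_Node split: if_splits)
    then show ?thesis
      using approx_le_mono[OF approx_le_refl KK] by (simp add: sweep_children_def)
  qed
  then have "approx_le (K * K') (\<delta> + ?D) (sweep F N l (Node ts) x \<theta>) (sweep F N l (Node ts) (incr v x) \<theta>)"
    unfolding sweep_Node total_incr[OF "1.prems"(1)]
  proof (rule approx_le_test[rotated 2])
    fix \<nu> assume "\<not> \<theta> \<le> total (Node ts) x + \<nu>"
    then show "approx_le K' ?D (F (Node ts) x) (F (Node ts) (incr v x))"
      using F[OF "1.prems", of x] \<open>\<theta> \<le> U\<close> by (auto elim!: approx_le_mono simp: add_increasing)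
  next
    show "emeasure N {\<nu>. \<not> \<theta> \<le> total (Node ts) x + \<nu>} \<le>
       K * emeasure N {\<nu>. \<not> \<theta> \<le> Suc (total (Node ts) x) + \<nu>} + \<delta>"
      using fail_shift[of \<theta> "Suc (total (Node ts) x)"] by simp
  qed auto
  moreover have "\<delta> + ?D = of_nat (depth (Node ts)) * \<delta> + D"
    using depth_pos[of "Node ts"] by (cases "depth (Node ts)") (auto simp: algebra_simps)
  ultimately show ?case by (simp only:)
qed

text \<open>With the threshold raised together with the weight, the tests above \<open>v\<close>
  have identical outcomes and are free. The price is that subtrees off the path to \<open>v\<close>
  now see a raised threshold; at most one of them is heavy enough to notice, and
  \<open>sweep_shift\<close> handles it.\<close>

lemma sweep_down:
  assumes F: "\<And>t x v. v \<in> leaves t \<Longrightarrow> depth t \<le> d \<Longrightarrow> total t x < U \<Longrightarrow>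
        approx_le K' D (F t (incr v x)) (F t x)"
    and K': "1 \<le> K'" and "\<theta> \<le> U" "v \<in> leaves t" "depth t \<le> d" "total t x + 2 * m < 2 * \<theta>"
  shows "approx_le (K * K') (of_nat (depth t) * \<delta> + D)
           (sweep F N l t (incr v x) (Suc \<theta>)) (sweep F N l t x \<theta>)"
  using assms(4-)
proof (induction t arbitrary: x v rule: nodes.induct)
  case (1 ts)
  have KK: "1 \<le> K * K'" using mult_mono[OF K_ge_1 K'] by simp
  let ?D = "of_nat (depth (Node ts)) * \<delta> + D"
  let ?s = "\<lambda>k. sweep F N l (ts ! k) (child k x) \<theta>"
  let ?s' = "\<lambda>k. sweep F N l (ts ! k) (child k (incr v x)) (Suc \<theta>)"
  have "approx_le (K * K') ?D (sweep_children F N l ts (incr v x) (Suc \<theta>)) (sweep_children F N l ts x \<theta>)"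
  proof (cases v)
    case (Cons k p)
    with "1.prems" have k: "k < length ts" "p \<in> leaves (ts ! k)"
      by (auto simp: Cons_in_leaves_Node)
    show ?thesis
    proof (cases "\<exists>j<length ts. j \<noteq> k \<and> \<theta> \<le> total (ts ! j) (child j x) + m")
      case False
      show ?thesis unfolding Cons
      proof (rule approx_le_sweep_children[OF k(1)])
        have "approx_le (K * K') (of_nat (depth (ts ! k)) * \<delta> + D)
            (sweep F N l (ts ! k) (child k (incr (k # p) x)) (Suc \<theta>)) (?s k)"
          using "1.prems" depth_child_less[OF k(1)] total_child_le[OF k(1), of x] k
          unfolding child_incr by (intro "1.IH") auto
        then show "approx_le (K * K') ?D
            (sweep F N l (ts ! k) (child k (incr (k # p) x)) (Suc \<theta>)) (?s k)"
          using depth_child_less[OF k(1)]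
          by (elim approx_le_mono) (auto intro!: mult_right_mono add_mono)
      next
        fix j assume j: "j < length ts" "j \<noteq> k"
        with False have "total (ts ! j) (child j x) + m < \<theta>" by (meson not_le)
        then show "sweep F N l (ts ! j) (child j (incr (k # p) x)) (Suc \<theta>) = ?s j"
          using j by (simp add: child_incr_other sweep_light)
      qed
    next
      \<comment> \<open>The heavy path leaves the path to \<open>v\<close> at this node. Child
        \<open>j\<close> pays for the raised threshold, child \<open>k\<close> for the extra unit;
        the draws are independent, so the two costs multiply, and this happens only once since
        \<open>k\<close> is light and drops at once.\<close>
      case True
      then obtain j where j: "j < length ts" "j \<noteq> k" "\<theta> \<le> total (ts ! j) (child j x) + m" by blast
      have light: "total (ts ! i) (child i x) + m < \<theta>" if "i < length ts" "i \<noteq> j" for i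
        using total_two_children_le[OF that(1) j(1) that(2), of x] j(3) "1.prems" by linarith
      have "approx_le K (of_nat (depth (ts ! j)) * \<delta>) (?s' j) (?s j)"
        using j total_child_le[OF j(1), of x] "1.prems"
        unfolding Cons by (subst child_incr_other) (auto intro!: sweep_shift)
      then have sj: "approx_le K (of_nat (depth (Node ts)) * \<delta>) (?s' j) (?s j)"
        using depth_child_less[OF j(1)]
        by (elim approx_le_mono) (auto intro!: mult_right_mono)
      \<comment> \<open>The extra unit is offset by the raised threshold, so child \<open>k\<close>
        stays light.\<close>
      have "?s' k = F (ts ! k) (incr p (child k x))"
        using light[OF k(1)] j k by (simp add: Cons child_incr sweep_light total_incr)
      moreover have "?s k = F (ts ! k) (child k x)"
        using light[OF k(1)] j k by (simp add: sweep_light)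
      moreover have "approx_le K' D (F (ts ! k) (incr p (child k x))) (F (ts ! k) (child k x))"
        using depth_child_less[OF k(1)] "1.prems" light[OF k(1)] j(2) \<open>\<theta> \<le> U\<close> k by (intro F) auto
      ultimately have sk: "approx_le K' D (?s' k) (?s k)" by simp
      have "?s' i = ?s i" if "i < length ts" "i \<noteq> j" "i \<noteq> k" for i
        using light[OF that(1,2)] that by (simp add: Cons child_incr_other sweep_light)
      then show ?thesis
        unfolding sweep_children_def using j k
        by (intro approx_le_map approx_le_Pi_pmf_two[OF _ _ _ _ sj sk]) auto
    qed
  next
    case Nil
    with "1.prems" have "ts = []" by (auto simp: leaves_Node split: if_splits)
    then show ?thesis
      using approx_le_mono[OF approx_le_refl KK] by (simp add: sweep_children_def)
  qed
  moreover have "approx_le (K * K') ?D (F (Node ts) (incr v x)) (F (Node ts) x)"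
    if "\<not> \<theta> \<le> total (Node ts) x + \<nu>" for \<nu>
    using that F[OF "1.prems"(1,2), of x] \<open>\<theta> \<le> U\<close> mult_right_mono[OF K_ge_1, of K']
    by (auto elim!: approx_le_mono simp: add_increasing)
  ultimately show ?case
    unfolding sweep_Node total_incr[OF "1.prems"(1)]
    by (intro approx_le_bind_same) auto
qed

end

section \<open>The walk through all levels\<close>

text \<open>A subtree processed at level \<open>Suc i\<close> weighs less than
  \<open>T (Suc i) + m (Suc i)\<close>; \<open>gap\<close> converts this into the weight condition
  of \<open>sweep_down\<close>. \<open>thresholds_large\<close> makes sure that starting above the
  total weight changes nothing.\<close>

locale tree_labelling =
  fixes N :: "nat \<Rightarrow> nat pmf" and T m :: "nat \<Rightarrow> nat" and K \<delta> :: "nat \<Rightarrow> ennreal" and d :: nat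
  assumes noise_bounded: "\<And>i n. n \<in> set_pmf (N i) \<Longrightarrow> n \<le> m i"
    and noise_shift: "\<And>i. approx_le (K i) (\<delta> i) (N i) (map_pmf Suc (N i))"
    and one_le_K: "\<And>i. 1 \<le> K i"
    and gap: "\<And>i. T (Suc i) + m (Suc i) + 2 * m i \<le> 2 * T i"
    and thresholds_large: "\<And>i. i + m i < T i"
begin

sublocale sweep_level F "N i" "K i" "\<delta> i" "m i" for F i
  using noise_bounded noise_shift one_le_K by unfold_locales auto

primrec label :: "nat \<Rightarrow> rtree \<Rightarrow> (nat list \<Rightarrow> nat) \<Rightarrow> (nat list \<Rightarrow> nat) pmf" where
  "label 0 t x = return_pmf (\<lambda>_. 0)"
| "label (Suc i) t x = bind_pmf (N i) (\<lambda>\<eta>. sweep (label i) (N i) (Suc i) t x (T i + \<eta>))"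

lemma label_Suc_light:
  assumes "total t x + m i < T i"
  shows "label (Suc i) t x = label i t x"
  using assms by (simp add: sweep_light)

text \<open>By \<open>thresholds_large\<close>, a walk started above level \<open>total t x\<close>
  drops with certainty until it reaches that level.\<close>

lemma label_stable: "total t x \<le> i \<Longrightarrow> label i t x = label (total t x) t x"
proof (induction rule: dec_induct)
  case (step i)
  with thresholds_large[of i] show ?case by (subst label_Suc_light) auto
qed simp

text \<open>Two factors per level: one for a shift of the shared noise, one for the failing test at
  the end of the path.\<close>

definition K_total :: "nat \<Rightarrow> ennreal" where "K_total i = (\<Prod>j<i. K j * K j)"

text \<open>Per level, at most \<open>d\<close> tests and one shift of the shared noise can hit the
  boundary of the noise.\<close>

definition D_total :: "nat \<Rightarrow> ennreal" where "D_total i = (\<Sum>j<i. of_nat (d + 1) * \<delta> j)"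

lemma one_le_K_total: "1 \<le> K_total i"
proof (induction i)
  case (Suc i)
  then show ?case
    using mult_mono[OF Suc mult_mono[OF one_le_K[of i] one_le_K[of i]]] by (simp add: K_total_def)
qed (simp add: K_total_def)

text \<open>Induction on the level. To add a unit, both sides use the same shared noise and
  \<open>sweep_up\<close> applies. To remove one, the shared noise \<open>\<eta>\<close> of the
  larger input is paired with \<open>\<eta> - 1\<close> for the smaller one, and
  \<open>sweep_down\<close> applies. A failing subtree weighs less than \<open>T i + m i\<close>,
  which is the hypothesis for the next level down.\<close>

lemma label_private:
  assumes "v \<in> leaves t" "depth t \<le> d" "total t x < T i + m i"
  shows "approx_le (K_total i) (D_total i) (label i t x) (label i t (incr v x))"
    and "approx_le (K_total i) (D_total i) (label i t (incr v x)) (label i t x)"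
proof -
  have "approx_le (K_total i) (D_total i) (label i t x) (label i t (incr v x)) \<and>
     approx_le (K_total i) (D_total i) (label i t (incr v x)) (label i t x)"
    using assms
  proof (induction i arbitrary: t x v)
    case 0
    then show ?case using approx_le_refl by (simp add: K_total_def D_total_def)
  next
    case (Suc i)
    let ?KK = "K i * K_total i" and ?D = "of_nat (depth t) * \<delta> i + D_total i"
    have K_Suc: "K_total (Suc i) = K i * ?KK"
      by (simp add: K_total_def mult_ac)
    have "\<delta> i + ?D = of_nat (depth t + 1) * \<delta> i + D_total i"
      by (simp add: algebra_simps)
    also have "\<dots> \<le> of_nat (d + 1) * \<delta> i + D_total i"
      using Suc.prems by (intro add_mono mult_right_mono of_nat_mono) auto
    finally have D_Suc: "\<delta> i + ?D \<le> D_total (Suc i)"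
      by (simp add: D_total_def add.commute)
    then have D_Suc': "?D \<le> D_total (Suc i)"
      using add_increasing[of "\<delta> i" ?D ?D] by (meson order.trans order.refl zero_le)
    have K_Suc': "?KK \<le> K_total (Suc i)"
      unfolding K_Suc using mult_right_mono[OF one_le_K[of i], of ?KK] by simp
    have "approx_le ?KK ?D (label (Suc i) t x) (label (Suc i) t (incr v x))"
      unfolding label.simps using Suc noise_bounded one_le_K_total
      by (intro approx_le_bind_same sweep_up[where U = "T i + m i" and d = d]) auto
    moreover have "approx_le (K i * ?KK) (\<delta> i + ?D) (label (Suc i) t (incr v x)) (label (Suc i) t x)"
    proof -
      \<comment> \<open>Writing the noise of the smaller input as a successor makes the subtraction
        of 1 exact. The value 0, which has no partner, lies outside the common support and is
        absorbed by \<open>\<delta> i\<close>.\<close>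
      have eq: "label (Suc i) t x = bind_pmf (map_pmf Suc (N i))
          (\<lambda>\<eta>. sweep (label i) (N i) (Suc i) t x (T i + \<eta> - 1))"
        by (simp add: bind_map_pmf)
      show ?thesis unfolding eq unfolding label.simps
      proof (rule approx_le_bind[OF noise_shift])
        fix \<eta> assume "\<eta> \<in> set_pmf (N i)" "\<eta> \<in> set_pmf (map_pmf Suc (N i))"
        then obtain \<eta>' where \<eta>': "\<eta> = Suc \<eta>'" "\<eta> \<le> m i" using noise_bounded by auto
        have "approx_le ?KK ?D (sweep (label i) (N i) (Suc i) t (incr v x) (Suc (T i + \<eta>')))
            (sweep (label i) (N i) (Suc i) t x (T i + \<eta>'))"
          using Suc one_le_K_total \<eta>' gap[of i]
          by (intro sweep_down[where U = "T i + m i" and d = d]) auto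
        then show "approx_le ?KK ?D (sweep (label i) (N i) (Suc i) t (incr v x) (T i + \<eta>))
            (sweep (label i) (N i) (Suc i) t x (T i + \<eta> - 1))"
          using \<eta>' by simp
      qed
    qed
    ultimately show ?case
      using approx_le_mono[OF _ K_Suc' D_Suc'] approx_le_mono[OF _ order.refl D_Suc]
      unfolding K_Suc by blast
  qed
  then show "approx_le (K_total i) (D_total i) (label i t x) (label i t (incr v x))"
    and "approx_le (K_total i) (D_total i) (label i t (incr v x)) (label i t x)" by auto
qed

section \<open>Sure accuracy of the labels\<close>

definition accurate :: "nat \<Rightarrow> nat \<Rightarrow> bool" where
  "accurate l w \<longleftrightarrow> w < T l + m l \<and> (\<forall>i. l = Suc i \<longrightarrow> T i \<le> w + m i)"

text \<open>A node that passes satisfies \<open>T i \<le> \<theta> \<le> w + m i\<close>, and its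
  upper bound is inherited from the root of the sweep since weights decrease downwards. A node that
  fails weighs less than \<open>\<theta> \<le> T i + m i\<close>, as required for
  \<open>F\<close>.\<close>

lemma sweep_accurate:
  assumes F: "\<And>t x f u. f \<in> set_pmf (F t x) \<Longrightarrow> total t x < T i + m i \<Longrightarrow> u \<in> nodes t \<Longrightarrow>
       accurate (f u) (weight t x u)"
    and \<theta>: "T i \<le> \<theta>" "\<theta> \<le> T i + m i"
    and "f \<in> set_pmf (sweep F (N i) (Suc i) t x \<theta>)" "total t x < T (Suc i) + m (Suc i)" "u \<in> nodes t"
  shows "accurate (f u) (weight t x u)"
  using assms(4-)
proof (induction t arbitrary: x f u rule: nodes.induct)
  case (1 ts)
  from "1.prems"(1) obtain \<nu> where \<nu>: "\<nu> \<in> set_pmf (N i)" and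
    f: "f \<in> set_pmf (if \<theta> \<le> total (Node ts) x + \<nu> then sweep_children F (N i) (Suc i) ts x \<theta>
                    else F (Node ts) x)"
    unfolding sweep_Node by auto
  have \<nu>_le: "\<nu> \<le> m i" using \<nu> by (rule noise_bounded)
  show ?case
  proof (cases "\<theta> \<le> total (Node ts) x + \<nu>")
    case True
    with f obtain g where g: "f = graft (Suc i) g"
      "\<And>k. k < length ts \<Longrightarrow> g k \<in> set_pmf (sweep F (N i) (Suc i) (ts ! k) (child k x) \<theta>)"
      by (auto simp: sweep_children_def set_Pi_pmf PiE_dflt_def)
    show ?thesis
    proof (cases u)
      case Nil
      then show ?thesis using g "1.prems" True \<theta> \<nu>_le by (auto simp: accurate_def)
    next
      case (Cons k p)
      with "1.prems" have k: "k < length ts" "p \<in> nodes (ts ! k)" by auto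
      have "accurate (g k p) (weight (ts ! k) (child k x) p)"
        using k g(2) total_child_le[OF k(1), of x] "1.prems" by (intro "1.IH") auto
      then show ?thesis using Cons g k by (simp add: weight_Cons)
    qed
  next
    case False
    then show ?thesis using f \<theta> "1.prems" by (intro F) auto
  qed
qed

lemma label_accurate:
  assumes "f \<in> set_pmf (label i t x)" "total t x < T i + m i" "u \<in> nodes t"
  shows "accurate (f u) (weight t x u)"
  using assms
proof (induction i arbitrary: t x f u)
  case 0
  then show ?case
    using weight_le_total[of t x u] by (auto simp: accurate_def)
next
  case (Suc i)
  from Suc.prems(1) obtain \<eta> where \<eta>: "\<eta> \<in> set_pmf (N i)"
    and f: "f \<in> set_pmf (sweep (label i) (N i) (Suc i) t x (T i + \<eta>))"
    by auto
  show ?case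
  proof (rule sweep_accurate[where F = "label i" and i = i, OF _ _ _ f Suc.prems(2,3)])
    show "accurate (g u) (weight s y u)"
      if "g \<in> set_pmf (label i s y)" "total s y < T i + m i" "u \<in> nodes s" for s y g u
      using that by (rule Suc.IH)
  qed (use noise_bounded[OF \<eta>] in auto)
qed

end

section \<open>Truncated geometric noise\<close>

text \<open>Only downward shifts of the noise occur, so a one-sided noise suffices: the probabilities grow
  geometrically up to \<open>m\<close>, where they may drop to 0 abruptly.\<close>

lemma exists_geometric_noise:
  fixes \<epsilon> \<delta> :: real and m :: nat
  assumes "\<epsilon> \<ge> 0" "exp (- \<epsilon> * m) \<le> \<delta>"
  shows "\<exists>N :: nat pmf. set_pmf N \<subseteq> {..m} \<and> approx_le (ennreal (exp \<epsilon>)) (ennreal \<delta>) N (map_pmf Suc N)"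
proof -
  define Z where "Z = (\<Sum>j\<le>m. exp (\<epsilon> * j))"
  define f where "f n = (if n \<le> m then exp (\<epsilon> * n) / Z else 0)" for n :: nat
  have Z_ge: "exp (\<epsilon> * m) \<le> Z"
    unfolding Z_def by (rule member_le_sum[of m]) auto
  have Z_pos: "Z > 0" using Z_ge exp_gt_zero[of "\<epsilon> * m"] by linarith
  have f_nonneg: "f n \<ge> 0" for n using Z_pos by (simp add: f_def)
  have "(\<integral>\<^sup>+n. ennreal (f n) \<partial>count_space UNIV) = (\<Sum>n\<le>m. ennreal (f n))"
    by (rule nn_integral_count_space'[where A = "{..m}"]) (auto simp: f_def)
  also have "\<dots> = ennreal (\<Sum>n\<le>m. f n)" using f_nonneg by (intro sum_ennreal) auto
  also have "(\<Sum>n\<le>m. f n) = 1"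
    using Z_pos by (simp add: f_def Z_def flip: sum_divide_distrib)
  finally have int1: "(\<integral>\<^sup>+n. ennreal (f n) \<partial>count_space UNIV) = 1" by simp
  define N where "N = embed_pmf f"
  have pmf_N: "pmf N n = f n" for n
    unfolding N_def using f_nonneg int1 by (intro pmf_embed_pmf) auto
  have "set_pmf N \<subseteq> {..m}" by (auto simp: set_pmf_eq pmf_N f_def split: if_splits)
  moreover have "approx_le (ennreal (exp \<epsilon>)) (ennreal \<delta>) N (map_pmf Suc N)"
    unfolding approx_le_def
  proof (intro allI impI)
    fix h :: "nat \<Rightarrow> ennreal" assume h: "\<forall>a. h a \<le> 1"
    \<comment> \<open>The point 0 is missed by \<open>Suc\<close>, so its mass is the whole additive
      error; \<open>Z\<close> is bounded below by its largest term.\<close>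
    have f0: "f 0 \<le> \<delta>"
    proof -
      have "f 0 = 1 / Z" by (simp add: f_def)
      also have "\<dots> \<le> 1 / exp (\<epsilon> * m)" using Z_ge Z_pos by (intro divide_left_mono) auto
      also have "\<dots> = exp (- \<epsilon> * m)" by (simp add: exp_minus field_simps)
      finally show ?thesis using assms by simp
    qed
    \<comment> \<open>At \<open>n = m\<close> the left side is 0, so the upper end of the support
      costs nothing.\<close>
    have f_Suc: "f (Suc n) \<le> exp \<epsilon> * f n" for n
      using Z_pos by (auto simp: f_def field_simps simp flip: exp_add)
    have "(\<integral>\<^sup>+a. h a \<partial>N) = (\<Sum>n. ennreal (f n) * h n)"
      by (simp add: nn_integral_measure_pmf nn_integral_count_space_nat pmf_N)
    also have "\<dots> = (\<Sum>n. ennreal (f (Suc n)) * h (Suc n)) + ennreal (f 0) * h 0"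
      by (subst suminf_offset[of _ 1]) (auto simp: add.commute)
    also have "\<dots> \<le> (\<Sum>n. ennreal (exp \<epsilon>) * (ennreal (f n) * h (Suc n))) + ennreal \<delta> * 1"
    proof (rule add_mono)
      have "ennreal (f (Suc n)) \<le> ennreal (exp \<epsilon>) * ennreal (f n)" for n
        using f_Suc[of n] by (simp add: ennreal_leI flip: ennreal_mult')
      then have "ennreal (f (Suc n)) * h (Suc n) \<le> ennreal (exp \<epsilon>) * (ennreal (f n) * h (Suc n))" for n
        unfolding mult.assoc[symmetric] by (rule mult_right_mono) auto
      then show "(\<Sum>n. ennreal (f (Suc n)) * h (Suc n)) \<le>
          (\<Sum>n. ennreal (exp \<epsilon>) * (ennreal (f n) * h (Suc n)))"
        by (rule suminf_le) auto
      show "ennreal (f 0) * h 0 \<le> ennreal \<delta> * 1"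
        using f0 h by (intro mult_mono ennreal_leI) auto
    qed
    also have "(\<Sum>n. ennreal (exp \<epsilon>) * (ennreal (f n) * h (Suc n))) =
        ennreal (exp \<epsilon>) * (\<integral>\<^sup>+a. h a \<partial>map_pmf Suc N)"
      unfolding nn_integral_map_pmf
      by (simp add: nn_integral_measure_pmf nn_integral_count_space_nat pmf_N)
    finally show "(\<integral>\<^sup>+a. h a \<partial>N) \<le> ennreal (exp \<epsilon>) * (\<integral>\<^sup>+a. h a \<partial>map_pmf Suc N) + ennreal \<delta>"
      by simp
  qed
  ultimately show ?thesis by blast
qed

section \<open>The mechanism\<close>

text \<open>The distance is a sum of natural numbers, so it equals 1 only if exactly one term is 1
  and the others vanish.\<close>

lemma neighbours_incr:
  assumes x: "x \<in> inputs t" and x': "x' \<in> inputs t" and dist: "l1_dist t x x' = 1"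
  obtains v where "v \<in> leaves t" "x' = incr v x \<or> x = incr v x'"
proof -
  define g where "g v = nat \<bar>int (x v) - int (x' v)\<bar>" for v
  have "l1_dist t x x' = real (\<Sum>v\<in>leaves t. g v)"
    unfolding l1_dist_def g_def of_nat_sum by (intro sum.cong) auto
  with dist have "(\<Sum>v\<in>leaves t. g v) = 1" by linarith
  then obtain v where v: "v \<in> leaves t" "g v = 1" "\<And>u. u \<in> leaves t \<Longrightarrow> v \<noteq> u \<Longrightarrow> g u = 0"
    unfolding sum_eq_1_iff[OF finite_leaves] by blast
  have eq: "x u = x' u" if "u \<noteq> v" for u
  proof (cases "u \<in> leaves t")
    case True
    then show ?thesis using v(3)[of u] that by (auto simp: g_def)
  next
    case False
    \<comment> \<open>Inputs are extensional: off the leaves both are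
      \<open>undefined\<close>.\<close>
    then show ?thesis using x x' by (auto simp: inputs_def PiE_def extensional_def)
  qed
  have "x' v = Suc (x v) \<or> x v = Suc (x' v)" using v(2) by (auto simp: g_def)
  then have "x' = incr v x \<or> x = incr v x'"
    using eq by (auto simp: incr_def fun_eq_iff)
  with v(1) that show thesis by blast
qed

lemma approx_le_measure:
  assumes "approx_le (ennreal (exp \<epsilon>)) (ennreal \<delta>) p q" "\<delta> \<ge> 0"
  shows "measure p S \<le> exp \<epsilon> * measure q S + \<delta>"
proof -
  have "(\<integral>\<^sup>+a. indicator S a \<partial>p) \<le> ennreal (exp \<epsilon>) * (\<integral>\<^sup>+a. indicator S a \<partial>q) + ennreal \<delta>"
    by (intro approx_leD[OF assms(1)]) (auto split: split_indicator)
  then have "ennreal (measure p S) \<le> ennreal (exp \<epsilon> * measure q S + \<delta>)"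
    using assms(2) by (simp add: measure_pmf.emeasure_eq_measure ennreal_mult ennreal_plus)
  then show ?thesis using assms(2) by (subst (asm) ennreal_le_iff) auto
qed

definition release :: "rtree \<Rightarrow> (nat \<Rightarrow> real) \<Rightarrow> (nat list \<Rightarrow> nat) pmf \<Rightarrow> (nat list \<Rightarrow> real) measure" where
  "release t est p = distr (measure_pmf p) (estimates t) (\<lambda>f. \<lambda>u\<in>nodes t. est (f u))"

lemma measurable_release:
  "(\<lambda>f. \<lambda>u\<in>nodes t. est (f u)) \<in> measurable (measure_pmf p) (estimates t)"
  by (auto simp: estimates_def space_PiM)

lemma prob_space_release: "prob_space (release t est p)"
  unfolding release_def by (rule measure_pmf.prob_space_distr[OF measurable_release])

lemma measure_release:
  assumes "S \<in> sets (estimates t)"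
  shows "measure (release t est p) S = measure p ((\<lambda>f. \<lambda>u\<in>nodes t. est (f u)) -` S)"
  unfolding release_def by (subst measure_distr[OF measurable_release assms]) simp

lemma RMSE_release_le:
  assumes B: "B \<ge> 0" and u: "u \<in> nodes t"
    and err: "\<And>f. f \<in> set_pmf p \<Longrightarrow> \<bar>est (f u) - z\<bar> \<le> \<alpha> * z + B"
  shows "RMSE \<alpha> (release t est p) (\<lambda>w. w u) z \<le> ennreal B"
proof -
  let ?e = "\<lambda>r. ennreal ((max (\<bar>r - z\<bar> - \<alpha> * z) 0)\<^sup>2)"
  have meas: "(\<lambda>\<omega>. \<omega> u) \<in> borel_measurable (estimates t)"
    unfolding estimates_def using u by (rule measurable_component_singleton)
  have "(\<integral>\<^sup>+\<omega>. ?e (\<omega> u) \<partial>release t est p) = (\<integral>\<^sup>+f. ?e ((\<lambda>u\<in>nodes t. est (f u)) u) \<partial>p)"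
    unfolding release_def
    by (rule nn_integral_distr[OF measurable_release]) (use meas in measurable)
  also have "\<dots> \<le> (\<integral>\<^sup>+f. ennreal (B\<^sup>2) \<partial>p)"
  proof (intro nn_integral_mono_AE, unfold AE_measure_pmf_iff, intro ballI ennreal_leI power_mono)
    fix f assume "f \<in> set_pmf p"
    from err[OF this] show "max (\<bar>(\<lambda>u\<in>nodes t. est (f u)) u - z\<bar> - \<alpha> * z) 0 \<le> B"
      using u B by auto
  qed auto
  finally have le: "(\<integral>\<^sup>+\<omega>. ?e (\<omega> u) \<partial>release t est p) \<le> ennreal (B\<^sup>2)" by simp
  then have "enn2real (\<integral>\<^sup>+\<omega>. ?e (\<omega> u) \<partial>release t est p) \<le> B\<^sup>2"
    by (intro enn2real_leI) auto
  then have "sqrt (enn2real (\<integral>\<^sup>+\<omega>. ?e (\<omega> u) \<partial>release t est p)) \<le> B"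
    using B real_le_lsqrt by auto
  \<comment> \<open>Finiteness is needed separately, because \<open>enn2real\<close> sends \<top> to
    0.\<close>
  moreover have "(\<integral>\<^sup>+\<omega>. ?e (\<omega> u) \<partial>release t est p) \<noteq> \<top>"
    using le by (auto simp: top_unique)
  ultimately show ?thesis
    unfolding RMSE_def ennsqrt_def by (auto intro: ennreal_leI)
qed

section \<open>Privacy and error of the released estimates\<close>

context tree_labelling
begin

text \<open>Starting at any level from \<open>total t x\<close> upwards gives the same distribution (\<open>label_stable\<close>), so the choice
  of a starting level that depends on the input costs no privacy.\<close>

definition mechanism :: "(nat \<Rightarrow> real) \<Rightarrow> rtree \<Rightarrow> (nat list \<Rightarrow> nat) \<Rightarrow> (nat list \<Rightarrow> real) measure" where
  "mechanism est t x = release t est (label (total t x) t x)"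

lemma mechanism_private:
  assumes d: "depth t \<le> d" and K: "\<And>i. K_total i \<le> ennreal (exp \<epsilon>)"
    and D: "\<And>i. D_total i \<le> ennreal D" and "D \<ge> 0"
  shows "differentially_private \<epsilon> D t (mechanism est t)"
  unfolding differentially_private_def
proof (intro ballI impI)
  fix x x' S assume x: "x \<in> inputs t" "x' \<in> inputs t" "l1_dist t x x' = 1"
    and S: "S \<in> sets (estimates t)"
  have *: "approx_le (ennreal (exp \<epsilon>)) (ennreal D) (label (total t y) t y)
          (label (total t (incr v y)) t (incr v y)) \<and>
        approx_le (ennreal (exp \<epsilon>)) (ennreal D) (label (total t (incr v y)) t (incr v y))
          (label (total t y) t y)" if v: "v \<in> leaves t" for v y
  proof -
    \<comment> \<open>This is the total weight of the larger neighbour; by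
      \<open>label_stable\<close> the smaller one may start at this level too, so
      \<open>label_private\<close> compares them at a common level.\<close>
    let ?i = "Suc (total t y)"
    have "total t y < T ?i + m ?i" using thresholds_large[of ?i] by linarith
    note priv = label_private[OF v d this]
    have "label (total t y) t y = label ?i t y"
      by (rule label_stable[symmetric]) simp
    moreover have "label (total t (incr v y)) t (incr v y) = label ?i t (incr v y)"
      using total_incr[OF v] by simp
    ultimately show ?thesis using priv approx_le_mono[OF _ K D] by metis
  qed
  obtain v where "v \<in> leaves t" "x' = incr v x \<or> x = incr v x'"
    using neighbours_incr[OF x] .
  then have "approx_le (ennreal (exp \<epsilon>)) (ennreal D) (label (total t x) t x) (label (total t x') t x')"
    using * by blast
  then show "measure (mechanism est t x) S \<le> exp \<epsilon> * measure (mechanism est t x') S + D"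
    unfolding mechanism_def measure_release[OF S] using \<open>D \<ge> 0\<close> by (rule approx_le_measure)
qed

lemma mechanism_mRMSE:
  assumes "B \<ge> 0" and est: "\<And>l w. accurate l w \<Longrightarrow> \<bar>est l - real w\<bar> \<le> \<alpha> * real w + B"
  shows "mRMSE \<alpha> t (mechanism est t) \<le> ennreal B"
  unfolding mRMSE_def mechanism_def
proof (intro SUP_least RMSE_release_le \<open>B \<ge> 0\<close> est)
  fix x u f assume "u \<in> nodes t" "f \<in> set_pmf (label (total t x) t x)"
  moreover have "total t x < T (total t x) + m (total t x)"
    using thresholds_large[of "total t x"] by linarith
  ultimately show "accurate (f u) (weight t x u)"
    using label_accurate[of f "total t x" t x u] by blast
qed

lemma mechanism_tree_algorithm: "tree_algorithm t (mechanism est t)"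
  unfolding tree_algorithm_def mechanism_def
  by (auto simp: prob_space_release) (auto simp: release_def)

lemma K_total_exp:
  assumes "\<And>i. K i = ennreal (exp (e i))"
  shows "K_total i = ennreal (exp (2 * (\<Sum>j<i. e j)))"
proof (induction i)
  case (Suc i)
  have "K_total (Suc i) = K_total i * (K i * K i)" by (simp add: K_total_def)
  also have "\<dots> = ennreal (exp (2 * (\<Sum>j<i. e j)) * (exp (e i) * exp (e i)))"
    unfolding Suc assms by (simp add: ennreal_mult)
  also have "exp (2 * (\<Sum>j<i. e j)) * (exp (e i) * exp (e i)) = exp (2 * (\<Sum>j<Suc i. e j))"
    by (simp flip: exp_add)
  finally show ?case .
qed (simp add: K_total_def)

lemma D_total_sum:
  assumes "\<And>i. \<delta> i = ennreal (c i)" "\<And>i. c i \<ge> 0"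
  shows "D_total i = ennreal (real (d + 1) * (\<Sum>j<i. c j))"
proof -
  have "D_total i = (\<Sum>j<i. ennreal (real (d + 1) * c j))"
    unfolding D_total_def assms(1) using assms(2)
    by (intro sum.cong) (simp_all add: ennreal_mult ennreal_of_nat_eq_real_of_nat del: of_nat_Suc of_nat_add)
  also have "\<dots> = ennreal (real (d + 1) * (\<Sum>j<i. c j))"
    using assms(2) by (subst sum_ennreal) (auto simp: sum_distrib_left)
  finally show ?thesis .
qed

end

section \<open>Choice of the parameters\<close>

lemma geometric_partial_sum_le:
  fixes b :: real assumes "0 < b" "b \<le> 1"
  shows "(\<Sum>j<n. (1 / (1 + b)) ^ j) \<le> 2 / b"
proof -
  have "(\<Sum>j<n. (1 / (1 + b)) ^ j) \<le> (\<Sum>j. (1 / (1 + b)) ^ j)"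
    using assms by (intro sum_le_suminf summable_geometric) auto
  also have "\<dots> = 1 / (1 - 1 / (1 + b))" using assms by (intro suminf_geometric) auto
  also have "\<dots> = (1 + b) / b" using assms by (simp add: field_simps)
  also have "\<dots> \<le> 2 / b" using assms by (intro divide_right_mono) auto
  finally show ?thesis .
qed

lemma tree_aggregation_small_alpha:
  fixes \<alpha> \<epsilon> \<delta> :: real
  assumes \<alpha>: "0 < \<alpha>" "\<alpha> < 1" and \<epsilon>: "\<epsilon> > 0" and \<delta>: "0 < \<delta>" "\<delta> < 1"
  shows "\<exists>A. tree_algorithm t A \<and> differentially_private \<epsilon> \<delta> t A \<and>
    mRMSE \<alpha> t A \<le> ennreal (192000 / \<alpha> ^ 3 * (1 / \<epsilon> * log 2 (2 * real (depth t) / \<delta>) + 1))"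
proof -
  \<comment> \<open>\<open>b\<close> sets both the ratio of noise to threshold and the growth rate
    of the thresholds. The resulting error of at most \<open>6 * (b * \<tau>s i)\<close> has to stay
    below \<open>\<alpha> * w\<close>, which is at least
    \<open>18 * (b * \<tau>s i)\<close>.\<close>
  define b where "b = \<alpha> / 20"
  define L where "L = log 2 (2 * real (depth t) / \<delta>)"
  \<comment> \<open>The noise of level 0 has range about \<open>b * \<tau>\<close> and privacy share
    \<open>\<epsilon> * b / 4\<close>; their product must reach \<open>3 * L / b\<close>, whence
    \<open>12 / b ^ 3 * (L / \<epsilon>)\<close>. The summand 1 gives
    \<open>b * \<tau> \<ge> 12\<close>, which makes rounding harmless.\<close>
  define \<tau> where "\<tau> = 12 / b ^ 3 * (L / \<epsilon> + 1)"
  define \<tau>s where "\<tau>s i = \<tau> * (1 + b) ^ (2 * i)" for i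
  define T where "T i = nat \<lceil>\<tau>s i\<rceil>" for i
  define m where "m i = nat \<lceil>b * \<tau>s i\<rceil>" for i
  \<comment> \<open>The shares decay like \<open>(1 + b) ^ i\<close> while the noise range grows
    like its square, so \<open>e i * m i\<close> still grows like \<open>(1 + b) ^ i\<close>. The
    sum of the shares is at most \<open>\<epsilon> / 2\<close>, and each is spent twice.\<close>
  define e where "e i = \<epsilon> * b / 4 * (1 / (1 + b)) ^ i" for i
  \<comment> \<open>These sum to at most \<open>\<delta> / (2 * depth t)\<close>, and
    \<open>depth t + 1 \<le> 2 * depth t\<close>.\<close>
  define c where "c i = \<delta> * b / (4 * depth t) * (1 / (1 + b)) ^ i" for i
  have b: "0 < b" "b \<le> 1/20" using \<alpha> by (auto simp: b_def)
  have d: "real (depth t) \<ge> 1" using depth_pos[of t] by linarith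
  have "2 * 1 \<le> 2 * real (depth t) / \<delta>"
    using d \<delta> by (simp add: field_simps)
  then have L: "L \<ge> 1" unfolding L_def by (subst le_log_iff) auto
  have \<tau>: "\<tau> \<ge> 12 / b ^ 3"
    unfolding \<tau>_def using b L \<epsilon> mult_left_mono[of 1 "L / \<epsilon> + 1" "12 / b ^ 3"] by simp
  have b3: "1 / b \<le> 1 / b ^ 3"
    using b power_decreasing[of 1 3 b] by (intro divide_left_mono) auto
  have \<tau>b: "b * \<tau> \<ge> 12"
  proof -
    have "12 / b \<le> \<tau>" using \<tau> b3 by simp
    then show ?thesis using b by (simp add: field_simps)
  qed
  have \<tau>_pos: "\<tau> > 0" using \<tau> b by (auto intro: less_le_trans[OF _ \<tau>])
  have \<tau>s_ge: "\<tau>s i \<ge> \<tau> * (1 + 2 * i * b)" for i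
    unfolding \<tau>s_def using Bernoulli_inequality[of b "2 * i"] b \<tau>_pos by (intro mult_left_mono) auto
  have \<tau>s_ge': "\<tau>s i \<ge> \<tau>" for i
  proof -
    have "\<tau> * 1 \<le> \<tau> * (1 + 2 * i * b)" using b \<tau>_pos by (intro mult_left_mono) auto
    with \<tau>s_ge[of i] show ?thesis by simp
  qed
  have b\<tau>s: "b * \<tau>s i \<ge> 12" for i
    using \<tau>b mult_left_mono[OF \<tau>s_ge'[of i], of b] b by linarith
  have m_lower: "b * \<tau>s i \<le> m i" for i unfolding m_def by linarith
  have m_upper: "m i \<le> 2 * (b * \<tau>s i)" for i
    unfolding m_def using b\<tau>s[of i] by linarith
  have T_lower: "\<tau>s i \<le> T i" for i unfolding T_def by linarith
  have T_upper: "T i \<le> \<tau>s i + b * \<tau>s i" for i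
    unfolding T_def using b\<tau>s[of i] \<tau>s_ge'[of i] \<tau>_pos by linarith
  have \<tau>s_0: "\<tau>s 0 = \<tau>" by (simp add: \<tau>s_def)
  have \<tau>s_Suc: "\<tau>s (Suc i) = (1 + b)\<^sup>2 * \<tau>s i" for i
    by (simp add: \<tau>s_def power2_eq_square)
  have \<tau>s_pos: "\<tau>s i > 0" for i using \<tau>s_ge'[of i] \<tau>_pos by linarith
  have poly_b: "(1 + b)\<^sup>2 * (1 + 3 * b) \<le> 1 + 6 * b"
  proof -
    have "(1 + b)\<^sup>2 * (1 + 3 * b) = 1 + 5 * b + b * (7 * b + 3 * (b * b))"
      by (simp add: power2_eq_square algebra_simps)
    moreover have "b * b \<le> 1/20 * b" using b by (intro mult_right_mono) auto
    then have "7 * b + 3 * (b * b) \<le> 1" using b by linarith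
    then have "b * (7 * b + 3 * (b * b)) \<le> b * 1" using b by (intro mult_left_mono) auto
    ultimately show ?thesis by simp
  qed
  have next_upper: "T (Suc i) + m (Suc i) \<le> \<tau>s i + 6 * (b * \<tau>s i)" for i
  proof -
    have "real (T (Suc i) + m (Suc i)) \<le> \<tau>s (Suc i) * (1 + 3 * b)"
      using T_upper[of "Suc i"] m_upper[of "Suc i"] by (simp add: algebra_simps)
    also have "\<dots> = ((1 + b)\<^sup>2 * (1 + 3 * b)) * \<tau>s i"
      unfolding \<tau>s_Suc by (simp add: mult_ac)
    also have "\<dots> \<le> (1 + 6 * b) * \<tau>s i"
      using \<tau>s_pos[of i] by (intro mult_right_mono poly_b) auto
    finally show ?thesis by (simp add: algebra_simps)
  qed
  have b\<tau>s_le: "b * \<tau>s i \<le> \<tau>s i / 20" for i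
    using mult_right_mono[OF b(2), of "\<tau>s i"] \<tau>s_pos[of i] by simp
  have e_nonneg: "e i \<ge> 0" for i unfolding e_def using b \<epsilon> by simp
  have c_pos: "c i > 0" for i unfolding c_def using b \<delta> d by simp
  \<comment> \<open>The logarithm of \<open>1 / c i\<close> has three terms of at most
    \<open>L / b\<close> each and one linear in \<open>i\<close>. Bernoulli's inequality puts their
    sum below \<open>3 * L / b * (1 + b) ^ i\<close>, which the choice of \<open>\<tau>\<close>
    matches.\<close>
  have noise: "exp (- e i * m i) \<le> c i" for i
  proof -
    have ln_c: "- ln (c i) = ln (2 * depth t / \<delta>) + ln 2 + ln (1 / b) + i * ln (1 + b)"
      unfolding c_def using b \<delta> d
      using ln_realpow[of "2 :: real" 2] by (simp add: ln_mult ln_div ln_realpow)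
    have "ln (2 * depth t / \<delta>) = L * ln 2" unfolding L_def by (simp add: log_def)
    also have "\<dots> \<le> L * 1" using L ln_2_less_1 by (intro mult_left_mono) auto
    also have "\<dots> \<le> L / b" using L b by (simp add: field_simps)
    finally have 1: "ln (2 * depth t / \<delta>) \<le> L / b" .
    have "1 \<le> L / b" using L b by (simp add: field_simps)
    then have 2: "ln 2 \<le> L / b" using ln_2_less_1 by linarith
    have "ln (1 / b) \<le> 1 / b" using ln_le_minus_one[of "1 / b"] b by simp
    also have "\<dots> \<le> L / b" using L b by (simp add: divide_right_mono)
    finally have 3: "ln (1 / b) \<le> L / b" .
    have 4: "i * ln (1 + b) \<le> 3 * (L / b) * (i * b)"
    proof -
      have "i * ln (1 + b) \<le> i * b" using b ln_add_one_self_le_self[of b] by (intro mult_left_mono) auto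
      also have "\<dots> \<le> (3 * (L / b)) * (i * b)"
        using mult_right_mono[of 1 "3 * (L / b)" "i * b"] \<open>1 \<le> L / b\<close> b by simp
      finally show ?thesis .
    qed
    have "- ln (c i) \<le> 3 * (L / b) + 3 * (L / b) * (i * b)"
      unfolding ln_c using 1 2 3 4 by linarith
    also have "\<dots> = 3 * L / b * (1 + i * b)" by (simp add: distrib_left)
    also have "\<dots> \<le> 3 * L / b * (1 + b) ^ i"
      using Bernoulli_inequality[of b i] b L by (intro mult_left_mono) auto
    also have "\<dots> \<le> (\<epsilon> * b\<^sup>2 * \<tau> / 4) * (1 + b) ^ i"
    proof (intro mult_right_mono)
      have "\<epsilon> * b\<^sup>2 * \<tau> / 4 = 3 * (L + \<epsilon>) / b"
        unfolding \<tau>_def using b \<epsilon> by (simp add: field_simps power2_eq_square power3_eq_cube)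
      also have "\<dots> \<ge> 3 * L / b" using b \<epsilon> by (intro divide_right_mono) auto
      finally show "3 * L / b \<le> \<epsilon> * b\<^sup>2 * \<tau> / 4" .
    qed (use b in auto)
    also have "\<dots> = e i * (b * \<tau>s i)"
      unfolding e_def \<tau>s_def using b
      by (simp add: field_simps power2_eq_square power_mult power_mult_distrib)
    also have "\<dots> \<le> e i * m i" using m_lower e_nonneg by (intro mult_left_mono)
    finally have "- e i * m i \<le> ln (c i)" by simp
    then have "exp (- e i * m i) \<le> exp (ln (c i))" by (simp only: exp_le_cancel_iff)
    then show ?thesis using c_pos[of i] by simp
  qed
  have "\<exists>N :: nat pmf. set_pmf N \<subseteq> {..m i} \<and>
      approx_le (ennreal (exp (e i))) (ennreal (c i)) N (map_pmf Suc N)" for i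
    by (rule exists_geometric_noise[OF e_nonneg noise])
  then obtain N :: "nat \<Rightarrow> nat pmf" where N: "\<And>i. set_pmf (N i) \<subseteq> {..m i}"
      "\<And>i. approx_le (ennreal (exp (e i))) (ennreal (c i)) (N i) (map_pmf Suc (N i))"
    by metis
  interpret tree_labelling N T m "\<lambda>i. ennreal (exp (e i))" "\<lambda>i. ennreal (c i)" "depth t"
  proof
    fix i
    show "1 \<le> ennreal (exp (e i))" using e_nonneg[of i] by (simp flip: ennreal_1)
    \<comment> \<open>The left side is at most \<open>(1 + 10 * b) * \<tau>s i\<close>, and
      \<open>b \<le> 1/20\<close>.\<close>
    have "real (T (Suc i) + m (Suc i) + 2 * m i) \<le> real (2 * T i)"
      using next_upper[of i] m_upper[of i] T_lower[of i] b\<tau>s_le[of i] \<tau>s_pos[of i] by linarith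
    then show "T (Suc i) + m (Suc i) + 2 * m i \<le> 2 * T i" by linarith
    \<comment> \<open>By Bernoulli's inequality \<open>\<tau>s i\<close> exceeds
      \<open>24 * i\<close>, and \<open>m i\<close> is at most a tenth of
      \<open>\<tau>s i\<close>.\<close>
    have "\<tau> * (1 + 2 * real i * b) = \<tau> + 2 * real i * (b * \<tau>)" by (simp add: algebra_simps)
    moreover have "2 * real i * (b * \<tau>) \<ge> 2 * real i * 12" using \<tau>b by (intro mult_left_mono) auto
    ultimately have "\<tau>s i > 24 * real i" using \<tau>s_ge[of i] \<tau>_pos by linarith
    then have "real (i + m i) < real (T i)"
      using m_upper[of i] T_lower[of i] b\<tau>s_le[of i] \<tau>s_pos[of i] by linarith
    then show "i + m i < T i" by linarith
  qed (use N in auto)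
  have sum_e: "2 * (\<Sum>j<i. e j) \<le> \<epsilon>" for i
  proof -
    have "2 * (\<Sum>j<i. e j) = \<epsilon> * b / 2 * (\<Sum>j<i. (1 / (1 + b)) ^ j)"
      unfolding e_def by (simp flip: sum_distrib_left sum_divide_distrib)
    also have "\<dots> \<le> \<epsilon> * b / 2 * (2 / b)"
      using b \<epsilon> by (intro mult_left_mono geometric_partial_sum_le) auto
    finally show ?thesis using b by simp
  qed
  have sum_c: "real (depth t + 1) * (\<Sum>j<i. c j) \<le> \<delta>" for i
  proof -
    have "real (depth t + 1) * (\<Sum>j<i. c j) \<le> 2 * depth t * (\<Sum>j<i. c j)"
      using d c_pos by (intro mult_right_mono sum_nonneg) (auto intro: less_imp_le)
    also have "\<dots> = \<delta> * b / 2 * (\<Sum>j<i. (1 / (1 + b)) ^ j)"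
      unfolding c_def using d by (simp flip: sum_distrib_left sum_divide_distrib)
    also have "\<dots> \<le> \<delta> * b / 2 * (2 / b)"
      using b \<delta> by (intro mult_left_mono geometric_partial_sum_le) auto
    finally show ?thesis using b by simp
  qed
  have "differentially_private \<epsilon> \<delta> t (mechanism est t)" for est
  proof (rule mechanism_private)
    show "K_total i \<le> ennreal (exp \<epsilon>)" for i
      using sum_e[of i] by (subst K_total_exp[OF refl]) (auto intro: ennreal_leI)
    show "D_total i \<le> ennreal \<delta>" for i
      using sum_c[of i] c_pos by (subst D_total_sum[OF refl]) (auto intro: ennreal_leI less_imp_le)
  qed (use \<delta> in auto)
  moreover
  \<comment> \<open>Label 0 carries no lower bound on the weight; its error is below
    \<open>T 0 + m 0\<close> and makes up the additive term \<open>2 * \<tau>\<close>. For the other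
    labels the relative error alone suffices.\<close>
  define est where "est l = (case l of 0 \<Rightarrow> 0 | Suc i \<Rightarrow> real (T i))" for l
  have "mRMSE \<alpha> t (mechanism est t) \<le> ennreal (2 * \<tau>)"
  proof (rule mechanism_mRMSE)
    fix l w assume acc: "accurate l w"
    show "\<bar>est l - real w\<bar> \<le> \<alpha> * real w + 2 * \<tau>"
    proof (cases l)
      case 0
      with acc have "real w < T 0 + m 0" by (simp add: accurate_def flip: of_nat_add)
      also have "\<dots> \<le> 2 * \<tau>"
        using T_upper[of 0] m_upper[of 0] b\<tau>s_le[of 0] \<tau>_pos \<tau>s_0 by linarith
      finally show ?thesis using 0 \<alpha> by (simp add: est_def add_increasing)
    next
      case (Suc i)
      then have est_Suc: "est l = T i" by (simp add: est_def)
      from Suc acc have w: "real w < T (Suc i) + m (Suc i)" "real (T i) \<le> real w + m i"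
        by (auto simp: accurate_def simp flip: of_nat_add)
      have "real w \<ge> 9 / 10 * \<tau>s i"
        using w m_upper[of i] T_lower[of i] b\<tau>s_le[of i] by linarith
      then have "b * real w \<ge> b * (9 / 10 * \<tau>s i)" using b by (intro mult_left_mono) auto
      then have "20 * (b * real w) \<ge> 18 * (b * \<tau>s i)" by simp
      moreover have "20 * (b * real w) = \<alpha> * real w" by (simp add: b_def)
      moreover have "\<bar>est l - real w\<bar> \<le> 6 * (b * \<tau>s i)"
        using w m_upper[of i] next_upper[of i] T_lower[of i] b\<tau>s[of i] est_Suc by linarith
      ultimately show ?thesis using b\<tau>s[of i] \<tau>_pos by linarith
    qed
  qed (use \<tau>_pos in auto)
  \<comment> \<open>The constant is \<open>2 * 12 * 20 ^ 3\<close>.\<close>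
  moreover have "2 * \<tau> = 192000 / \<alpha> ^ 3 * (1 / \<epsilon> * L + 1)"
    unfolding \<tau>_def b_def by (simp add: power_divide)
  ultimately show ?thesis
    using mechanism_tree_algorithm unfolding L_def by metis
qed

lemma tree_aggregation_large_alpha:
  assumes "\<alpha> \<ge> 1" "\<epsilon> \<ge> 0" "\<delta> \<ge> 0"
  shows "\<exists>A. tree_algorithm t A \<and> differentially_private \<epsilon> \<delta> t A \<and> mRMSE \<alpha> t A \<le> 0"
proof (intro exI conjI)
  let ?A = "\<lambda>_ :: nat list \<Rightarrow> nat. release t (\<lambda>_. 0) (return_pmf (\<lambda>_. 0))"
  show "tree_algorithm t ?A"
    unfolding tree_algorithm_def by (auto simp: prob_space_release) (auto simp: release_def)
  show "differentially_private \<epsilon> \<delta> t ?A"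
    unfolding differentially_private_def
  proof (intro ballI impI)
    fix S
    let ?p = "measure (release t (\<lambda>_. 0) (return_pmf (\<lambda>_. 0))) S"
    show "?p \<le> exp \<epsilon> * ?p + \<delta>"
      using mult_right_mono[of 1 "exp \<epsilon>" ?p] assms by simp
  qed
  have "RMSE \<alpha> (?A x) (\<lambda>w. w u) (weight t x u) \<le> ennreal 0" if "u \<in> nodes t" for x u
    using assms that mult_right_mono[of 1 \<alpha> "weight t x u"] by (intro RMSE_release_le) auto
  then show "mRMSE \<alpha> t ?A \<le> 0"
    unfolding mRMSE_def by (intro SUP_least) simp
qed

theorem theorem21:
  "\<exists>C::real. C > 0 \<and>
     (\<forall>(\<alpha>::real) (\<epsilon>::real) (\<delta>::real) (t::rtree).
        \<alpha> > 0 \<longrightarrow> \<epsilon> > 0 \<longrightarrow> 0 < \<delta> \<longrightarrow> \<delta> < 1 \<longrightarrow>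
        (\<exists>A. tree_algorithm t A \<and> differentially_private \<epsilon> \<delta> t A \<and>
           mRMSE \<alpha> t A \<le>
             ennreal (C / \<alpha> ^ 3 * (1 / \<epsilon> * log 2 (2 * real (depth t) / \<delta>) + 1))))"
proof (intro exI[of _ 192000] conjI allI impI)
  fix \<alpha> \<epsilon> \<delta> :: real and t
  assume *: "\<alpha> > 0" "\<epsilon> > 0" "0 < \<delta>" "\<delta> < 1"
  show "\<exists>A. tree_algorithm t A \<and> differentially_private \<epsilon> \<delta> t A \<and> mRMSE \<alpha> t A \<le>
      ennreal (192000 / \<alpha> ^ 3 * (1 / \<epsilon> * log 2 (2 * real (depth t) / \<delta>) + 1))"
  proof (cases "\<alpha> < 1")
    case True
    with * show ?thesis by (intro tree_aggregation_small_alpha)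
  next
    case False
    with * tree_aggregation_large_alpha[of \<alpha> \<epsilon> \<delta> t] show ?thesis
      by (auto intro: order.trans[OF _ zero_le])
  qed
qed simp

end
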